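(* For every positive integer $n$ and every odd positive integer $m=2k+1$, $$N(O(2n+1),m)=\binom{n+[m/2]}{[m/2]}.$$
   Context: $O(N)$ is the group of real $N\times N$ orthogonal matrices. $N(G,m)$ denotes the number of conjugacy classes of $G$ (under conjugation by elements of $G$) contained in $\{x\in G: x^m=1\}$. $[\cdot]$ denotes the integer part (floor). *)

theory Defs
  imports "HOL-Analysis.Analysis" "HOL-Algebra.Group"
begin

definition orthogonal_group :: "(real ^ 'd ^ 'd) monoid" where
  "orthogonal_group = \<lparr>carrier = {A. orthogonal_matrix A}, mult = (**), one = mat 1\<rparr>"

lemma orthogonal_group_simps [simp]:
  "carrier orthogonal_group = {A :: real ^ 'd ^ 'd. orthogonal_matrix A}"
  "A \<otimes>\<^bsub>orthogonal_group\<^esub> B = A ** B"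
  "\<one>\<^bsub>orthogonal_group\<^esub> = (mat 1 :: real ^ 'd ^ 'd)"
  for A B :: "real ^ 'd ^ 'd"
  by (simp_all add: orthogonal_group_def)

lemma group_orthogonal_group: "Group.group (orthogonal_group :: (real ^ 'd ^ 'd) monoid)"
proof (rule groupI)
  fix A :: "real ^ 'd ^ 'd"
  assume "A \<in> carrier orthogonal_group"
  then show "\<exists>B\<in>carrier orthogonal_group. B \<otimes>\<^bsub>orthogonal_group\<^esub> A = \<one>\<^bsub>orthogonal_group\<^esub>"
    by (intro bexI[of _ "transpose A"]) (auto simp: orthogonal_matrix_def)
qed (auto simp: orthogonal_matrix_mul orthogonal_matrix_id matrix_mul_assoc)

lemma inv_orthogonal_group:
  fixes A :: "real ^ 'd ^ 'd"
  assumes "orthogonal_matrix A"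
  shows "inv\<^bsub>orthogonal_group\<^esub> A = transpose A"
  using assms
  by (intro group.inv_equality[OF group_orthogonal_group]) (auto simp: orthogonal_matrix_def)

definition conj_class :: "('a, 'b) monoid_scheme \<Rightarrow> 'a \<Rightarrow> 'a set" where
  "conj_class G x = {g \<otimes>\<^bsub>G\<^esub> x \<otimes>\<^bsub>G\<^esub> inv\<^bsub>G\<^esub> g | g. g \<in> carrier G}"

definition conj_classes :: "('a, 'b) monoid_scheme \<Rightarrow> 'a set set" where
  "conj_classes G = conj_class G ` carrier G"

text \<open>As \<^const>\<open>card\<close> returns 0 on infinite sets, a positive value of this number
  entails that there are only finitely many such classes.\<close>

definition num_conj_classes_exponent :: "('a, 'b) monoid_scheme \<Rightarrow> nat \<Rightarrow> nat" where
  "num_conj_classes_exponent G m =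
     card {C \<in> conj_classes G. C \<subseteq> {x \<in> carrier G. x [^]\<^bsub>G\<^esub> m = \<one>\<^bsub>G\<^esub>}}"

end

theory Submission
  imports Defs "HOL-Combinatorics.Permutations"
begin

text \<open>Let \<open>f\<close> be an orthogonal map of a space of dimension \<open>2 n + 1\<close> with \<open>f\<^sup>m = id\<close>, \<open>m = 2 k + 1\<close>.
  A discrete cosine transform along orbits shows that every nonzero invariant subspace contains an
  eigenvector of \<open>f + f\<^sup>-\<^sup>1\<close> with eigenvalue \<open>2 cos (2 \<pi> j / m)\<close>, \<open>j \<le> k\<close>. Splitting off planes one at
  a time gives an orthonormal basis in which \<open>f\<close> consists of \<open>n\<close> plane rotations by angles
  \<open>2 \<pi> j / m\<close> and one fixed vector. The multiset of the \<open>n\<close> indices \<open>j\<close> determines \<open>f\<close> up to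
  conjugation, and it is recovered from the dimensions of the eigenspaces of \<open>f + f\<^sup>-\<^sup>1\<close>. Hence the
  classes correspond to the multisets of size \<open>n\<close> over \<open>{0, \<dots>, k}\<close>.\<close>

section \<open>Angles, orthonormal sequences and rotation bases\<close>

definition root_angle :: "nat \<Rightarrow> nat \<Rightarrow> real" where
  "root_angle m j = 2 * pi * real j / real m"

definition orthonormal_upto :: "nat \<Rightarrow> (nat \<Rightarrow> 'a::real_inner) \<Rightarrow> bool" where
  "orthonormal_upto N b \<longleftrightarrow> (\<forall>i<N. \<forall>j<N. b i \<bullet> b j = of_bool (i = j))"

text \<open>For \<open>t = 0\<close> this only says that \<open>v\<close> and \<open>w\<close> are
  fixed, so a pair of fixed vectors counts as a rotated plane.\<close>

definition rotates :: "('a::real_vector \<Rightarrow> 'a) \<Rightarrow> real \<Rightarrow> 'a \<Rightarrow> 'a \<Rightarrow> bool" where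
  "rotates f t v w \<longleftrightarrow>
     f v = cos t *\<^sub>R v + sin t *\<^sub>R w \<and> f w = cos t *\<^sub>R w - sin t *\<^sub>R v"

text \<open>The pairs at positions \<open>2 * i\<close> and \<open>2 * i + 1\<close> span the
  rotated planes, and position \<open>2 * n\<close> holds the axis. The values of \<open>c\<close>
  are left unbounded here; the bound by \<open>k\<close> is a separate hypothesis wherever
  uniqueness of the indices is at stake.\<close>

definition rotation_basis ::
    "nat \<Rightarrow> nat \<Rightarrow> ('a::real_inner \<Rightarrow> 'a) \<Rightarrow> (nat \<Rightarrow> nat) \<Rightarrow> (nat \<Rightarrow> 'a) \<Rightarrow> bool" where
  "rotation_basis m n f c b \<longleftrightarrow>
     orthonormal_upto (2 * n + 1) b \<and>
     (\<forall>i<n. rotates f (root_angle m (c i)) (b (2 * i)) (b (2 * i + 1))) \<and>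
     f (b (2 * n)) = b (2 * n)"

section \<open>Cosine sums and the values of cosine and sine at the root angles\<close>

lemma sum_lessThan_Suc_shift_periodic:
  fixes g :: "nat \<Rightarrow> 'a::ab_group_add"
  assumes "g m = g 0"
  shows "(\<Sum>t<m. g (Suc t)) = (\<Sum>t<m. g t)"
  using sum.lessThan_Suc_shift[of g m] assms by simp

lemma cos_root_angle_eq_1_iff:
  assumes "t < m"
  shows "cos (root_angle m t) = 1 \<longleftrightarrow> t = 0"
proof
  assume "cos (root_angle m t) = 1"
  then obtain i :: int where "2 * pi * real t / real m = real_of_int i * 2 * pi"
    unfolding cos_one_2pi_int root_angle_def by blast
  then have "real t = real_of_int i * real m"
    using assms by (simp add: field_simps)
  then have "int t = i * int m"
    by (metis of_int_eq_iff of_int_mult of_int_of_nat_eq)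
  then show "t = 0"
    using assms by (metis dvd_triv_right int_dvd_int_iff nat_dvd_not_less not_gr_zero)
qed (simp add: root_angle_def)

lemma cos_mult_root_angle_period:
  assumes "m > 0"
  shows "cos (real m * root_angle m t) = 1" "sin (real m * root_angle m t) = 0"
  using assms cos_int_2pin[of "int t"] sin_int_2pin[of "int t"]
  by (simp_all add: root_angle_def mult_ac)

text \<open>Summing \<open>2 cos a cos ((j + 1) a) = cos (j a) + cos ((j + 2) a)\<close> over a full
  period gives \<open>2 cos a * S = 2 * S\<close> for the sum \<open>S\<close> in question, and
  \<open>cos a\<close> differs from 1 because \<open>0 < t < m\<close>.\<close>

lemma sum_cos_root_angle_eq_0:
  assumes "0 < t" "t < m"
  shows "(\<Sum>j<m. cos (real j * root_angle m t)) = 0"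
proof -
  let ?a = "root_angle m t"
  let ?c = "\<lambda>j::nat. cos (real j * ?a)"
  have period: "?c m = ?c 0" "?c (Suc m) = ?c (Suc 0)"
    using cos_mult_root_angle_period[of m t] assms by (simp_all add: distrib_right cos_add)
  have "2 * cos ?a * ?c (Suc j) = ?c j + ?c (Suc (Suc j))" for j
    using cos_add[of "real (Suc j) * ?a" ?a] cos_diff[of "real (Suc j) * ?a" ?a]
    by (simp add: algebra_simps)
  then have "2 * cos ?a * (\<Sum>j<m. ?c (Suc j)) = (\<Sum>j<m. ?c j) + (\<Sum>j<m. ?c (Suc (Suc j)))"
    by (simp add: sum_distrib_left sum.distrib)
  then have "2 * cos ?a * (\<Sum>j<m. ?c j) = 2 * (\<Sum>j<m. ?c j)"
    using sum_lessThan_Suc_shift_periodic[of ?c m]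
      sum_lessThan_Suc_shift_periodic[of "\<lambda>j. ?c (Suc j)" m] period by simp
  then show ?thesis
    using cos_root_angle_eq_1_iff[of t m] assms by simp
qed

text \<open>The angles with \<open>j \<le> k\<close> lie between 0 and \<open>pi\<close>, where the
  cosine is injective. This is what lets eigenvalues distinguish the indices.\<close>

lemma inj_on_cos_root_angle: "inj_on (\<lambda>j. cos (root_angle (2 * k + 1) j)) {..k}"
proof (rule inj_onI)
  fix i j assume ij: "i \<in> {..k}" "j \<in> {..k}"
    and eq: "cos (root_angle (2 * k + 1) i) = cos (root_angle (2 * k + 1) j)"
  have "0 \<le> root_angle (2 * k + 1) i \<and> root_angle (2 * k + 1) i \<le> pi" if "i \<in> {..k}" for i
    using that mult_left_mono[of "2 * real i" "2 * real k + 1" pi]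
    by (simp add: root_angle_def field_simps)
  then have "root_angle (2 * k + 1) i = root_angle (2 * k + 1) j"
    using cos_inj_pi[of "root_angle (2 * k + 1) i" "root_angle (2 * k + 1) j"] ij eq by blast
  then show "i = j"
    by (simp add: root_angle_def field_simps)
qed

text \<open>Oddness of the order matters here: for an even order, the index equal to half the order
  would give the angle \<open>pi\<close>.\<close>

lemma sin_root_angle_neq_0:
  assumes "0 < j" "j \<le> k"
  shows "sin (root_angle (2 * k + 1) j) \<noteq> 0"
proof -
  have "0 < root_angle (2 * k + 1) j" "root_angle (2 * k + 1) j < pi"
    using assms mult_strict_left_mono[of "2 * real j" "2 * real k + 1" pi]
    by (simp_all add: root_angle_def field_simps)
  then show ?thesis
    using sin_gt_zero by (metis less_irrefl)
qed

section \<open>Eigenvectors of \<open>f + f^-1\<close> and the planes they generate\<close>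

lemma funpow_mem: "f ` W \<subseteq> W \<Longrightarrow> u \<in> W \<Longrightarrow> (f ^^ t) u \<in> W"
  by (induction t) auto

text \<open>The projections of \<open>u\<close> to the eigenspaces of \<open>f + f\<^sup>-\<^sup>1\<close> are the discrete cosine
  transforms of its orbit; they add up to a multiple of \<open>u\<close>, so one of them is nonzero.\<close>

lemma periodic_linear_eigenvector:
  fixes f :: "'a::real_vector \<Rightarrow> 'a"
  assumes lin: "linear f" and period: "f ^^ (2 * k + 1) = id"
    and W: "subspace W" "f ` W \<subseteq> W" and u: "u \<in> W" "u \<noteq> 0"
  obtains j v where "j \<le> k" "v \<in> W" "v \<noteq> 0"
    "f (f v) + v = (2 * cos (root_angle (2 * k + 1) j)) *\<^sub>R f v"
proof -
  define m where "m = 2 * k + 1"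
  have m: "m > 0" by (simp add: m_def)
  define x where "x t = (f ^^ t) u" for t
  have x_Suc: "f (x t) = x (Suc t)" for t
    by (simp add: x_def)
  have x_period: "x m = x 0" "x (Suc m) = x (Suc 0)"
    using period by (simp_all add: x_def m_def)
  define v where "v j = (\<Sum>t<m. cos (real t * root_angle m j) *\<^sub>R x t)" for j
  have vW: "v j \<in> W" for j
    unfolding v_def x_def using W u
    by (intro subspace_sum subspace_scale funpow_mem) auto
  \<comment> \<open>The eigenvalue equation of \<open>f + f^-1\<close> is multiplied by
    \<open>f\<close> to avoid the inverse. Cyclic shifts write all three terms over the same orbit
    points \<open>x (Suc (Suc t))\<close>, where the product formula for cosines compares the
    coefficients.\<close>
  have eig: "f (f (v j)) + v j = (2 * cos (root_angle m j)) *\<^sub>R f (v j)" for j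
  proof -
    let ?a = "root_angle m j"
    let ?g = "\<lambda>t. cos (real t * ?a) *\<^sub>R x t"
    let ?h = "\<lambda>t. cos (real t * ?a) *\<^sub>R x (Suc t)"
    have per: "cos (real m * ?a) = 1" "cos (real (Suc m) * ?a) = cos ?a"
      using cos_mult_root_angle_period[OF m, of j] by (simp_all add: distrib_right cos_add)
    have f1: "f (v j) = (\<Sum>t<m. ?h t)"
      by (simp add: v_def linear_sum[OF lin] linear_scale[OF lin] x_Suc)
    have f2: "f (f (v j)) = (\<Sum>t<m. cos (real t * ?a) *\<^sub>R x (Suc (Suc t)))"
      by (simp add: f1 linear_sum[OF lin] linear_scale[OF lin] x_Suc)
    have s1: "f (v j) = (\<Sum>t<m. ?h (Suc t))"
      unfolding f1 using sum_lessThan_Suc_shift_periodic[of ?h m] per x_period by simp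
    have s2: "v j = (\<Sum>t<m. ?g (Suc (Suc t)))"
      unfolding v_def
      using sum_lessThan_Suc_shift_periodic[of ?g m]
        sum_lessThan_Suc_shift_periodic[of "\<lambda>t. ?g (Suc t)" m] per x_period by simp
    have "2 * cos ?a * cos (real (Suc t) * ?a)
        = cos (real t * ?a) + cos (real (Suc (Suc t)) * ?a)" for t
      using cos_add[of "real (Suc t) * ?a" ?a] cos_diff[of "real (Suc t) * ?a" ?a]
      by (simp add: algebra_simps)
    then have "(2 * cos ?a) *\<^sub>R (\<Sum>t<m. ?h (Suc t))
        = (\<Sum>t<m. (cos (real t * ?a) + cos (real (Suc (Suc t)) * ?a)) *\<^sub>R x (Suc (Suc t)))"
      by (simp add: scaleR_sum_right)
    also have "\<dots> = f (f (v j)) + (\<Sum>t<m. ?g (Suc (Suc t)))"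
      by (simp add: f2 scaleR_add_left sum.distrib)
    finally show ?thesis
      using s1 s2 by simp
  qed
  have "(\<Sum>j<m. v j) = (\<Sum>t<m. \<Sum>j<m. cos (real t * root_angle m j) *\<^sub>R x t)"
    unfolding v_def by (rule sum.swap)
  \<comment> \<open>The angle \<open>real t * root_angle m j\<close> is symmetric in
    \<open>t\<close> and \<open>j\<close>, so the coefficient of \<open>x t\<close> is a full cosine
    sum: it vanishes for \<open>t > 0\<close> and equals \<open>m\<close> for
    \<open>t = 0\<close>.\<close>
  also have "\<dots> = (\<Sum>t<m. (\<Sum>j<m. cos (real j * root_angle m t)) *\<^sub>R x t)"
    by (simp add: scaleR_sum_left root_angle_def mult_ac)
  also have "\<dots> = (\<Sum>t<m. if t = 0 then real m *\<^sub>R x 0 else 0)"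
    by (intro sum.cong refl) (auto simp: sum_cos_root_angle_eq_0, simp add: root_angle_def)
  also have "\<dots> = real m *\<^sub>R u"
    using m by (simp add: x_def)
  finally have "(\<Sum>j<m. v j) \<noteq> 0"
    using u m by simp
  then obtain j where j: "j < m" "v j \<noteq> 0"
    by (meson lessThan_iff sum.neutral)
  show thesis
  proof (cases "j \<le> k")
    case True
    then show ?thesis
      using that[of j "v j"] vW eig j by (simp add: m_def)
  next
    case False
    \<comment> \<open>An index above \<open>k\<close> is reflected to \<open>m - j\<close>, which is
      at most \<open>k\<close> and has the same cosine; the vector stays the same.\<close>
    have "root_angle m (m - j) = 2 * pi - root_angle m j"
      using j by (simp add: root_angle_def of_nat_diff field_simps)
    then have "cos (root_angle m (m - j)) = cos (root_angle m j)"
      by simp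
    then show ?thesis
      using that[of "m - j" "v j"] vW eig[of j] j False by (simp add: m_def)
  qed
qed

text \<open>The equation says that \<open>(f - 1)^2\<close> kills \<open>v\<close>. Orthogonality
  excludes a Jordan block: the inner product with \<open>f v\<close> yields
  \<open>v \<bullet> f v = v \<bullet> v\<close>, whence \<open>f v - v\<close> has length
  0.\<close>

lemma orthogonal_eigenvector_fixed:
  fixes f :: "'a::real_inner \<Rightarrow> 'a"
  assumes "orthogonal_transformation f" "f (f v) + v = 2 *\<^sub>R f v"
  shows "f v = v"
proof -
  have ip: "f x \<bullet> f y = x \<bullet> y" for x y
    using assms(1) by (simp add: orthogonal_transformation_def)
  have "(f (f v) + v) \<bullet> f v = (2 *\<^sub>R f v) \<bullet> f v"
    using assms(2) by simp
  then have "v \<bullet> f v = v \<bullet> v"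
    by (simp add: inner_add_left inner_add_right ip inner_commute)
  then have "(f v - v) \<bullet> (f v - v) = 0"
    by (simp add: inner_diff_left inner_diff_right ip inner_commute)
  then show ?thesis by simp
qed

text \<open>The inner product of the eigenvalue equation with \<open>f v\<close> gives
  \<open>v \<bullet> f v = cos t\<close>. So \<open>f v - cos t *\<^sub>R v\<close> is the component
  of \<open>f v\<close> orthogonal to \<open>v\<close>, of length \<open>|sin t|\<close>, and
  \<open>w\<close> is its normalisation up to sign.\<close>

lemma orthogonal_eigenvector_rotates:
  fixes f :: "'a::real_inner \<Rightarrow> 'a"
  assumes f: "orthogonal_transformation f" and s: "sin t \<noteq> 0"
    and v: "v \<bullet> v = 1" "f (f v) + v = (2 * cos t) *\<^sub>R f v"
  defines "w \<equiv> (1 / sin t) *\<^sub>R (f v - cos t *\<^sub>R v)"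
  shows "v \<bullet> w = 0" "w \<bullet> w = 1" "rotates f t v w"
proof -
  have ip: "f x \<bullet> f y = x \<bullet> y" for x y
    using f by (simp add: orthogonal_transformation_def)
  have lin: "linear f"
    using f by (rule orthogonal_transformation_linear)
  have "f (f v) \<bullet> f v + v \<bullet> f v = 2 * cos t * (f v \<bullet> f v)"
    using v(2) by (metis inner_add_left inner_scaleR_left)
  then have vf: "v \<bullet> f v = cos t"
    using v(1) by (simp add: ip inner_commute)
  show "v \<bullet> w = 0"
    using v vf by (simp add: w_def inner_diff_right)
  have "(f v - cos t *\<^sub>R v) \<bullet> (f v - cos t *\<^sub>R v) = 1 - cos t * cos t"
    using v vf by (simp add: inner_diff_left inner_diff_right ip inner_commute)
  also have "\<dots> = sin t * sin t"
    using sin_cos_squared_add[of t] by (simp add: power2_eq_square)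
  finally show "w \<bullet> w = 1"
    using s by (simp add: w_def)
  have fv: "f v = cos t *\<^sub>R v + sin t *\<^sub>R w"
    using s by (simp add: w_def)
  have "sin t *\<^sub>R f w = f (f v) - cos t *\<^sub>R f v"
    using s by (simp add: w_def linear_scale[OF lin] linear_diff[OF lin])
  also have "f (f v) = (2 * cos t) *\<^sub>R f v - v"
    using v(2) by (simp add: algebra_simps)
  also have "(2 * cos t) *\<^sub>R f v - v - cos t *\<^sub>R f v = cos t *\<^sub>R f v - v"
    by (simp add: algebra_simps flip: scaleR_2)
  also have "\<dots> = (cos t * sin t) *\<^sub>R w - (1 - cos t * cos t) *\<^sub>R v"
    by (simp add: fv algebra_simps)
  also have "1 - cos t * cos t = sin t * sin t"
    using sin_cos_squared_add[of t] by (simp add: power2_eq_square)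
  finally have "sin t *\<^sub>R f w = sin t *\<^sub>R (cos t *\<^sub>R w - sin t *\<^sub>R v)"
    by (simp add: algebra_simps)
  then have "f w = cos t *\<^sub>R w - sin t *\<^sub>R v"
    using s by (simp only: scaleR_cancel_left) simp
  with fv show "rotates f t v w"
    by (simp add: rotates_def)
qed

section \<open>Orthonormal sequences in Euclidean space\<close>

lemma orthonormal_uptoD:
  "orthonormal_upto N b \<Longrightarrow> i < N \<Longrightarrow> j < N \<Longrightarrow> b i \<bullet> b j = of_bool (i = j)"
  by (simp add: orthonormal_upto_def)

lemma orthonormal_upto_inj_on:
  assumes "orthonormal_upto N b"
  shows "inj_on b {..<N}"
proof (rule inj_onI)
  fix i j assume ij: "i \<in> {..<N}" "j \<in> {..<N}" and eq: "b i = b j"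
  have "b i \<bullet> b j = 1"
    using orthonormal_uptoD[OF assms, of j j] ij eq by simp
  then show "i = j"
    using orthonormal_uptoD[OF assms, of i j] ij by (simp split: if_splits)
qed

lemma orthonormal_upto_independent:
  fixes b :: "nat \<Rightarrow> 'a::euclidean_space"
  assumes "orthonormal_upto N b"
  shows "independent (b ` {..<N})"
proof (rule pairwise_orthogonal_independent)
  show "pairwise orthogonal (b ` {..<N})"
    using orthonormal_uptoD[OF assms] by (auto simp: pairwise_def orthogonal_def)
  show "0 \<notin> b ` {..<N}"
    using orthonormal_uptoD[OF assms] by fastforce
qed

lemma orthonormal_upto_le_DIM:
  fixes b :: "nat \<Rightarrow> 'a::euclidean_space"
  assumes "orthonormal_upto N b"
  shows "N \<le> DIM('a)"
  using independent_card_le[OF orthonormal_upto_independent[OF assms]]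
    card_image[OF orthonormal_upto_inj_on[OF assms]] by simp

text \<open>The difference of the two sides is orthogonal to every \<open>b j\<close>; these span
  the space by dimension, so it is orthogonal to itself.\<close>

lemma orthonormal_upto_expansion:
  fixes b :: "nat \<Rightarrow> 'a::euclidean_space"
  assumes b: "orthonormal_upto N b" and N: "N = DIM('a)"
  shows "(\<Sum>i<N. (b i \<bullet> x) *\<^sub>R b i) = x"
proof -
  let ?y = "x - (\<Sum>i<N. (b i \<bullet> x) *\<^sub>R b i)"
  have card: "card (b ` {..<N}) = DIM('a)"
    using card_image[OF orthonormal_upto_inj_on[OF b]] N by simp
  have ind: "independent (b ` {..<N})"
    by (rule orthonormal_upto_independent[OF b])
  have span: "span (b ` {..<N}) = UNIV"
    using dim_eq_full[of "b ` {..<N}"] dim_eq_card_independent[OF ind] card by metis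
  have "b j \<bullet> ?y = 0" if j: "j < N" for j
  proof -
    have "b j \<bullet> (\<Sum>i<N. (b i \<bullet> x) *\<^sub>R b i) = (\<Sum>i<N. (b i \<bullet> x) * of_bool (j = i))"
      using orthonormal_uptoD[OF b j] by (simp add: inner_sum_right)
    also have "\<dots> = (\<Sum>i<N. if i = j then b i \<bullet> x else 0)"
      by (rule sum.cong) auto
    also have "\<dots> = b j \<bullet> x"
      using j by simp
    finally show ?thesis
      by (simp add: inner_diff_right)
  qed
  then have "orthogonal ?y ?y"
    using orthogonal_to_span[of ?y "b ` {..<N}" ?y] span
    by (auto simp: orthogonal_def inner_commute)
  then show ?thesis
    by (simp add: orthogonal_self)
qed

lemma orthonormal_upto_Suc:
  assumes "orthonormal_upto N b" "\<And>i. i < N \<Longrightarrow> b i \<bullet> v = 0" "v \<bullet> v = 1"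
  shows "orthonormal_upto (Suc N) (b(N := v))"
  using assms by (auto simp: orthonormal_upto_def less_Suc_eq inner_commute)

lemma nonzero_orthogonal_exists:
  fixes b :: "nat \<Rightarrow> 'a::euclidean_space"
  assumes "N < DIM('a)"
  obtains u where "u \<noteq> 0" "\<And>i. i < N \<Longrightarrow> b i \<bullet> u = 0"
proof -
  have "dim (b ` {..<N}) \<le> card (b ` {..<N})"
    by (rule dim_le_card') simp
  also have "\<dots> \<le> N"
    using card_image_le[of "{..<N}" b] by simp
  finally have "dim (b ` {..<N}) < DIM('a)"
    using assms by simp
  then obtain u where u: "u \<noteq> 0" "\<And>y. y \<in> span (b ` {..<N}) \<Longrightarrow> orthogonal u y"
    by (rule orthogonal_to_subspace_exists) blast
  have "b i \<bullet> u = 0" if "i < N" for i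
    using u(2)[of "b i"] that by (simp add: orthogonal_def inner_commute span_base)
  with u(1) show thesis
    by (rule that)
qed

section \<open>Splitting off rotated planes\<close>

text \<open>Since \<open>f x\<close> is orthogonal to \<open>f v\<close> and \<open>f w\<close>, it
  is orthogonal to \<open>v\<close> and \<open>w\<close>: the rotation matrix is inverted by the two
  linear combinations in the proof.\<close>

lemma rotates_orthogonal_invariant:
  assumes f: "orthogonal_transformation f" and r: "rotates f t v w"
    and x: "v \<bullet> x = 0" "w \<bullet> x = 0"
  shows "v \<bullet> f x = 0" "w \<bullet> f x = 0"
proof -
  have "f v \<bullet> f x = 0" "f w \<bullet> f x = 0"
    using f x by (simp_all add: orthogonal_transformation_def)
  then have e: "cos t * (v \<bullet> f x) + sin t * (w \<bullet> f x) = 0"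
    "cos t * (w \<bullet> f x) - sin t * (v \<bullet> f x) = 0"
    using r by (simp_all add: rotates_def inner_add_left inner_diff_left)
  have "(cos t * cos t + sin t * sin t) * (v \<bullet> f x)
      = cos t * (cos t * (v \<bullet> f x) + sin t * (w \<bullet> f x))
      - sin t * (cos t * (w \<bullet> f x) - sin t * (v \<bullet> f x))"
    by (simp add: algebra_simps del: sin_cos_squared_add3)
  then show "v \<bullet> f x = 0"
    unfolding e by simp
  have "(cos t * cos t + sin t * sin t) * (w \<bullet> f x)
      = sin t * (cos t * (v \<bullet> f x) + sin t * (w \<bullet> f x))
      + cos t * (cos t * (w \<bullet> f x) - sin t * (v \<bullet> f x))"
    by (simp add: algebra_simps del: sin_cos_squared_add3)
  then show "w \<bullet> f x = 0"
    unfolding e by simp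
qed

lemma less_double_cases:
  fixes i :: nat
  assumes "i < 2 * p"
  obtains q where "q < p" "i = 2 * q" | q where "q < p" "i = 2 * q + 1"
proof (cases "even i")
  case True
  then show thesis
    using that(1)[of "i div 2"] assms by simp
next
  case False
  then show thesis
    using that(2)[of "i div 2"] assms by simp
qed

lemma rotates_complement_invariant:
  fixes b :: "nat \<Rightarrow> 'a::real_inner"
  assumes f: "orthogonal_transformation f"
    and r: "\<And>i. i < p \<Longrightarrow> rotates f (t i) (b (2 * i)) (b (2 * i + 1))"
  defines "W \<equiv> {x. \<forall>i<2 * p. b i \<bullet> x = 0}"
  shows "f ` W \<subseteq> W"
proof -
  have "b i \<bullet> f x = 0" if x: "x \<in> W" and i: "i < 2 * p" for x i
  proof -
    have "b (2 * q) \<bullet> f x = 0 \<and> b (2 * q + 1) \<bullet> f x = 0" if "q < p" for q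
      using x that rotates_orthogonal_invariant[OF f r[OF that], of x] by (simp add: W_def)
    then show ?thesis
      using i by (elim less_double_cases) auto
  qed
  then show ?thesis
    by (auto simp: W_def)
qed

lemma subspace_inner_eq_0: "subspace {x. \<forall>i<N. b i \<bullet> x = 0}"
  by (auto simp: subspace_def inner_add_right)

lemma unit_eigenvector_exists:
  fixes f :: "'a::real_inner \<Rightarrow> 'a"
  assumes f: "orthogonal_transformation f" and period: "f ^^ (2 * k + 1) = id"
    and W: "subspace W" "f ` W \<subseteq> W" and u: "u \<in> W" "u \<noteq> 0"
  obtains j v where "j \<le> k" "v \<in> W" "v \<bullet> v = 1"
    "f (f v) + v = (2 * cos (root_angle (2 * k + 1) j)) *\<^sub>R f v"
proof -
  have lin: "linear f"
    using f by (rule orthogonal_transformation_linear)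
  obtain j v where jv: "j \<le> k" "v \<in> W" "v \<noteq> 0"
    "f (f v) + v = (2 * cos (root_angle (2 * k + 1) j)) *\<^sub>R f v"
    using periodic_linear_eigenvector[OF lin period W u] by blast
  let ?v = "(1 / norm v) *\<^sub>R v"
  have "f (f ?v) + ?v = (1 / norm v) *\<^sub>R (f (f v) + v)"
    by (simp add: linear_scale[OF lin] scaleR_add_right)
  also have "\<dots> = (2 * cos (root_angle (2 * k + 1) j)) *\<^sub>R f ?v"
    unfolding jv(4) by (simp add: linear_scale[OF lin])
  finally have "f (f ?v) + ?v = (2 * cos (root_angle (2 * k + 1) j)) *\<^sub>R f ?v" .
  moreover have "?v \<bullet> ?v = 1"
    using jv(3) by (simp add: dot_square_norm power2_eq_square)
  moreover have "?v \<in> W"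
    using W(1) jv(2) by (rule subspace_scale)
  ultimately show thesis
    using that jv(1) by blast
qed

text \<open>The partner of \<open>v\<close> is a combination of \<open>v\<close> and
  \<open>f v\<close>, so it stays in the invariant subspace.\<close>

lemma rotated_pair_exists:
  fixes f :: "'a::real_inner \<Rightarrow> 'a"
  assumes f: "orthogonal_transformation f" and j: "0 < j" "j \<le> k"
    and W: "subspace W" "f ` W \<subseteq> W" and v: "v \<in> W" "v \<bullet> v = 1"
    "f (f v) + v = (2 * cos (root_angle (2 * k + 1) j)) *\<^sub>R f v"
  obtains w where "w \<in> W" "v \<bullet> w = 0" "w \<bullet> w = 1" "rotates f (root_angle (2 * k + 1) j) v w"
proof -
  let ?t = "root_angle (2 * k + 1) j"
  let ?w = "(1 / sin ?t) *\<^sub>R (f v - cos ?t *\<^sub>R v)"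
  have "?w \<in> W"
    using W v by (intro subspace_scale subspace_diff) auto
  then show thesis
    using that orthogonal_eigenvector_rotates[OF f sin_root_angle_neq_0[OF j] v(2,3)] by blast
qed

text \<open>An eigenvector of nonzero index brings its own partner. If the first one found is fixed,
  a second one is sought orthogonally to it, for which the bound on \<open>N\<close> leaves room:
  either that one has a partner, or two fixed vectors form a plane rotated by the angle 0.\<close>

lemma rotated_pair_in_complement:
  fixes f :: "'a::euclidean_space \<Rightarrow> 'a" and b :: "nat \<Rightarrow> 'a"
  assumes f: "orthogonal_transformation f" and period: "f ^^ (2 * k + 1) = id"
    and N: "Suc N < DIM('a)"
  defines "W \<equiv> {x. \<forall>i<N. b i \<bullet> x = 0}"
  assumes inv: "f ` W \<subseteq> W"
  obtains j v w where "j \<le> k" "v \<in> W" "w \<in> W" "v \<bullet> v = 1" "w \<bullet> w = 1" "v \<bullet> w = 0"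
    "rotates f (root_angle (2 * k + 1) j) v w"
proof -
  have sub: "subspace W"
    unfolding W_def by (rule subspace_inner_eq_0)
  obtain u where u: "u \<in> W" "u \<noteq> 0"
    using nonzero_orthogonal_exists[of N b] N by (auto simp: W_def)
  obtain j v where v: "j \<le> k" "v \<in> W" "v \<bullet> v = 1"
    "f (f v) + v = (2 * cos (root_angle (2 * k + 1) j)) *\<^sub>R f v"
    using unit_eigenvector_exists[OF f period sub inv u] by blast
  show thesis
  proof (cases "j = 0")
    case False
    then show ?thesis
      using rotated_pair_exists[OF f _ v(1) sub inv v(2-4)] v that by blast
  next
    case True
    then have fv: "f v = v"
      using orthogonal_eigenvector_fixed[OF f, of v] v(4) by (simp add: root_angle_def)
    define b' where "b' = b(N := v)"
    define W' where "W' = {x. \<forall>i<Suc N. b' i \<bullet> x = 0}"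
    have W': "x \<in> W' \<longleftrightarrow> x \<in> W \<and> v \<bullet> x = 0" for x
      by (auto simp: W'_def b'_def W_def less_Suc_eq)
    have sub': "subspace W'"
      unfolding W'_def by (rule subspace_inner_eq_0)
    have "v \<bullet> f x = v \<bullet> x" for x
      using f fv unfolding orthogonal_transformation_def by metis
    then have inv': "f ` W' \<subseteq> W'"
      using inv by (auto simp: W' image_subset_iff)
    obtain u' where u': "u' \<in> W'" "u' \<noteq> 0"
      using nonzero_orthogonal_exists[of "Suc N" b'] N by (auto simp: W'_def)
    obtain j' v' where v': "j' \<le> k" "v' \<in> W'" "v' \<bullet> v' = 1"
      "f (f v') + v' = (2 * cos (root_angle (2 * k + 1) j')) *\<^sub>R f v'"
      using unit_eigenvector_exists[OF f period sub' inv' u'] by blast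
    show ?thesis
    proof (cases "j' = 0")
      \<comment> \<open>The fixed vector \<open>v\<close> is dropped: the plane is generated by
        \<open>v'\<close> alone, and its partner is taken in \<open>W\<close>.\<close>
      case False
      then show ?thesis
        using rotated_pair_exists[OF f _ v'(1) sub inv _ v'(3,4)] v' that W' by blast
    next
      case True
      then have "f v' = v'"
        using orthogonal_eigenvector_fixed[OF f, of v'] v'(4) by (simp add: root_angle_def)
      then have "rotates f (root_angle (2 * k + 1) 0) v v'"
        using fv by (simp add: rotates_def root_angle_def)
      then show ?thesis
        using that[of 0 v v'] v v' W' by simp
    qed
  qed
qed

text \<open>Each induction step adds one plane inside the orthogonal complement of the planes found
  so far, which \<open>f\<close> preserves.\<close>

lemma rotation_pairs_exist:
  fixes f :: "'a::euclidean_space \<Rightarrow> 'a"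
  assumes f: "orthogonal_transformation f" and period: "f ^^ (2 * k + 1) = id"
    and "2 * p \<le> DIM('a)"
  shows "\<exists>c b. (\<forall>i<p. c i \<le> k) \<and> orthonormal_upto (2 * p) b \<and>
    (\<forall>i<p. rotates f (root_angle (2 * k + 1) (c i)) (b (2 * i)) (b (2 * i + 1)))"
  using assms(3)
proof (induction p)
  case 0
  then show ?case by (simp add: orthonormal_upto_def)
next
  case (Suc p)
  then obtain c b where c: "\<And>i. i < p \<Longrightarrow> c i \<le> k" and b: "orthonormal_upto (2 * p) b"
    and r: "\<And>i. i < p \<Longrightarrow> rotates f (root_angle (2 * k + 1) (c i)) (b (2 * i)) (b (2 * i + 1))"
    by auto
  have inv: "f ` {x. \<forall>i<2 * p. b i \<bullet> x = 0} \<subseteq> {x. \<forall>i<2 * p. b i \<bullet> x = 0}"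
    using r by (rule rotates_complement_invariant[OF f])
  have dim: "Suc (2 * p) < DIM('a)"
    using Suc.prems by simp
  obtain j v w where jvw: "j \<le> k" "v \<in> {x. \<forall>i<2 * p. b i \<bullet> x = 0}"
    "w \<in> {x. \<forall>i<2 * p. b i \<bullet> x = 0}" "v \<bullet> v = 1" "w \<bullet> w = 1" "v \<bullet> w = 0"
    "rotates f (root_angle (2 * k + 1) j) v w"
    by (rule rotated_pair_in_complement[OF f period dim inv])
  let ?b = "b(2 * p := v, Suc (2 * p) := w)" and ?c = "c(p := j)"
  have "orthonormal_upto (Suc (Suc (2 * p))) ?b"
    using b jvw by (intro orthonormal_upto_Suc) (auto simp: less_Suc_eq)
  then have "orthonormal_upto (2 * Suc p) ?b"
    by simp
  moreover have "rotates f (root_angle (2 * k + 1) (?c i)) (?b (2 * i)) (?b (2 * i + 1))"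
    if "i < Suc p" for i
    using that r[of i] jvw(7) by (auto simp: less_Suc_eq)
  moreover have "?c i \<le> k" if "i < Suc p" for i
    using that c jvw(1) by (auto simp: less_Suc_eq)
  ultimately show ?case
    by blast
qed

text \<open>In odd dimension the orthogonal complement of the rotated pairs is a line, where no
  rotation by an angle in \<open>(0, pi)\<close> fits.\<close>

lemma rotation_basis_exists:
  fixes f :: "'a::euclidean_space \<Rightarrow> 'a"
  assumes f: "orthogonal_transformation f" and period: "f ^^ (2 * k + 1) = id"
    and dim: "DIM('a) = 2 * n + 1"
  obtains c b where "\<And>i. i < n \<Longrightarrow> c i \<le> k" "rotation_basis (2 * k + 1) n f c b"
proof -
  obtain c b where c: "\<And>i. i < n \<Longrightarrow> c i \<le> k" and b: "orthonormal_upto (2 * n) b"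
    and r: "\<And>i. i < n \<Longrightarrow> rotates f (root_angle (2 * k + 1) (c i)) (b (2 * i)) (b (2 * i + 1))"
    using rotation_pairs_exist[OF f period, of n] dim by auto
  define W where "W = {x. \<forall>i<2 * n. b i \<bullet> x = 0}"
  have sub: "subspace W"
    unfolding W_def by (rule subspace_inner_eq_0)
  have inv: "f ` W \<subseteq> W"
    unfolding W_def using r by (rule rotates_complement_invariant[OF f])
  obtain u where u: "u \<in> W" "u \<noteq> 0"
    using nonzero_orthogonal_exists[of "2 * n" b] dim by (auto simp: W_def)
  obtain j v where v: "j \<le> k" "v \<in> W" "v \<bullet> v = 1"
    "f (f v) + v = (2 * cos (root_angle (2 * k + 1) j)) *\<^sub>R f v"
    using unit_eigenvector_exists[OF f period sub inv u] by blast
  have b': "orthonormal_upto (Suc (2 * n)) (b(2 * n := v))"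
    using b v by (intro orthonormal_upto_Suc) (auto simp: W_def)
  \<comment> \<open>Otherwise \<open>v\<close> would have a partner in \<open>W\<close>, giving
    \<open>2 * n + 2\<close> orthonormal vectors in dimension \<open>2 * n + 1\<close>.\<close>
  have "j = 0"
  proof (rule ccontr)
    assume "j \<noteq> 0"
    then obtain w where w: "w \<in> W" "v \<bullet> w = 0" "w \<bullet> w = 1"
      using rotated_pair_exists[OF f _ v(1) sub inv v(2-4)] by blast
    have "orthonormal_upto (Suc (Suc (2 * n))) (b(2 * n := v, Suc (2 * n) := w))"
      by (rule orthonormal_upto_Suc[OF b']) (use w in \<open>auto simp: W_def less_Suc_eq\<close>)
    then show False
      using orthonormal_upto_le_DIM dim by fastforce
  qed
  then have "f v = v"
    using orthogonal_eigenvector_fixed[OF f, of v] v(4) by (simp add: root_angle_def)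
  then have "rotation_basis (2 * k + 1) n f c (b(2 * n := v))"
    using b' r by (auto simp: rotation_basis_def)
  then show thesis
    using that c by blast
qed

section \<open>Recovering the multiset of indices from the eigenspaces\<close>

text \<open>A rotation plus its inverse is the scalar \<open>2 * cos t\<close>; as before, the
  equation is multiplied by \<open>f\<close>.\<close>

lemma rotates_eigen:
  assumes lin: "linear f" and r: "rotates f t v w"
  shows "f (f v) + v = (2 * cos t) *\<^sub>R f v"
proof -
  have fv: "f v = cos t *\<^sub>R v + sin t *\<^sub>R w" and fw: "f w = cos t *\<^sub>R w - sin t *\<^sub>R v"
    using r by (simp_all add: rotates_def)
  have "sin t *\<^sub>R f w + (cos t * cos t + sin t * sin t) *\<^sub>R v = cos t *\<^sub>R f v"
    unfolding fv fw by (simp add: algebra_simps del: sin_cos_squared_add3)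
  then have "sin t *\<^sub>R f w + v = cos t *\<^sub>R f v"
    by simp
  moreover have "f (f v) = cos t *\<^sub>R f v + sin t *\<^sub>R f w"
    by (subst fv) (simp add: linear_add[OF lin] linear_scale[OF lin])
  ultimately show ?thesis
    by (simp add: add.assoc flip: scaleR_2)
qed

text \<open>A quarter turn of the pair carries facts about the first vector over to the
  second.\<close>

lemma rotates_swap: "linear f \<Longrightarrow> rotates f t v w \<Longrightarrow> rotates f t w (- v)"
  by (simp add: rotates_def linear_neg)

text \<open>Position \<open>i\<close> belongs to the plane \<open>i div 2\<close>; the axis at
  position \<open>2 * n\<close> gets the index 0.\<close>

lemma rotation_basis_eigen:
  assumes lin: "linear f" and b: "rotation_basis m n f c b" and i: "i < 2 * n + 1"
  shows "f (f (b i)) + b i =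
    (2 * cos (root_angle m (if i < 2 * n then c (i div 2) else 0))) *\<^sub>R f (b i)"
proof (cases "i < 2 * n")
  case True
  have r: "rotates f (root_angle m (c q)) (b (2 * q)) (b (2 * q + 1))" if "q < n" for q
    using b that by (simp add: rotation_basis_def)
  from True show ?thesis
  proof (cases rule: less_double_cases)
    case (1 q)
    then show ?thesis
      using rotates_eigen[OF lin r[of q]] by simp
  next
    case (2 q)
    then show ?thesis
      using rotates_eigen[OF lin rotates_swap[OF lin r[of q]]] by simp
  qed
next
  case False
  then have "i = 2 * n" using i by simp
  then show ?thesis
    using b by (simp add: rotation_basis_def root_angle_def scaleR_2)
qed

text \<open>This is orthogonality of eigenspaces of the self-adjoint map \<open>f + f^-1\<close>:
  both inner products in the proof reduce to
  \<open>f x \<bullet> y + x \<bullet> f y\<close>.\<close>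

lemma eigenspace_inner_eq_0:
  assumes f: "orthogonal_transformation f"
    and x: "f (f x) + x = (2 * s) *\<^sub>R f x" and y: "f (f y) + y = (2 * t) *\<^sub>R f y"
    and "s \<noteq> t"
  shows "x \<bullet> y = 0"
proof -
  have ip: "f x \<bullet> f y = x \<bullet> y" for x y
    using f by (simp add: orthogonal_transformation_def)
  have "(f (f x) + x) \<bullet> f y = 2 * s * (f x \<bullet> f y)" "f x \<bullet> (f (f y) + y) = 2 * t * (f x \<bullet> f y)"
    unfolding x y by simp_all
  then have "f x \<bullet> y + x \<bullet> f y = 2 * s * (x \<bullet> y)" "x \<bullet> f y + f x \<bullet> y = 2 * t * (x \<bullet> y)"
    by (simp_all add: inner_add_left inner_add_right ip)
  then have "s * (x \<bullet> y) = t * (x \<bullet> y)"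
    by linarith
  then show ?thesis
    using \<open>s \<noteq> t\<close> by simp
qed

text \<open>Basis vectors of index \<open>j\<close> lie in the eigenspace, and all others are
  orthogonal to it because the cosine separates indices up to \<open>k\<close>. So the former are a
  basis of the eigenspace.\<close>

lemma rotation_basis_dim_eigenspace:
  fixes f :: "'a::euclidean_space \<Rightarrow> 'a"
  assumes f: "orthogonal_transformation f" and b: "rotation_basis (2 * k + 1) n f c b"
    and dim: "DIM('a) = 2 * n + 1" and c: "\<And>i. i < n \<Longrightarrow> c i \<le> k" and j: "j \<le> k"
  shows "dim {x. f (f x) + x = (2 * cos (root_angle (2 * k + 1) j)) *\<^sub>R f x}
    = card {i. i < 2 * n + 1 \<and> (if i < 2 * n then c (i div 2) else 0) = j}"
proof -
  define d where "d i = (if i < 2 * n then c (i div 2) else 0)" for i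
  let ?E = "{x. f (f x) + x = (2 * cos (root_angle (2 * k + 1) j)) *\<^sub>R f x}"
  let ?I = "{i. i < 2 * n + 1 \<and> d i = j}"
  have lin: "linear f"
    using f by (rule orthogonal_transformation_linear)
  have orth: "orthonormal_upto (2 * n + 1) b"
    using b by (simp add: rotation_basis_def)
  have eig: "f (f (b i)) + b i = (2 * cos (root_angle (2 * k + 1) (d i))) *\<^sub>R f (b i)"
    if "i < 2 * n + 1" for i
    unfolding d_def by (rule rotation_basis_eigen[OF lin b that])
  have d: "d i \<le> k" if "i < 2 * n + 1" for i
    using c that by (auto simp: d_def)
  have sub: "b ` ?I \<subseteq> ?E"
    using eig by auto
  have "?E \<subseteq> span (b ` ?I)"
  proof
    fix x assume x: "x \<in> ?E"
    have "(b i \<bullet> x) *\<^sub>R b i \<in> span (b ` ?I)" if i: "i < 2 * n + 1" for i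
    proof (cases "d i = j")
      case True
      then show ?thesis
        using i by (intro span_scale span_base) auto
    next
      case False
      then have "cos (root_angle (2 * k + 1) (d i)) \<noteq> cos (root_angle (2 * k + 1) j)"
        using inj_onD[OF inj_on_cos_root_angle[of k], of "d i" j] d[OF i] j by auto
      then have "b i \<bullet> x = 0"
        using eigenspace_inner_eq_0[OF f eig[OF i]] x by blast
      then show ?thesis
        by (simp add: span_zero)
    qed
    then have "(\<Sum>i<2 * n + 1. (b i \<bullet> x) *\<^sub>R b i) \<in> span (b ` ?I)"
      by (intro span_sum) auto
    then show "x \<in> span (b ` ?I)"
      using orthonormal_upto_expansion[OF orth] dim by simp
  qed
  moreover have "independent (b ` ?I)"
    by (rule independent_mono[OF orthonormal_upto_independent[OF orth]]) auto
  ultimately have "dim ?E = card (b ` ?I)"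
    using dim_unique[OF sub] by blast
  also have "\<dots> = card ?I"
    by (intro card_image inj_on_subset[OF orthonormal_upto_inj_on[OF orth]]) auto
  finally show ?thesis
    by (simp add: d_def)
qed

lemma card_eq_sum_of_bool:
  fixes n :: nat
  shows "card {i. i < n \<and> P i} = (\<Sum>i<n. of_bool (P i))"
proof -
  have "{i. i < n \<and> P i} = {..<n} \<inter> {i. P i}"
    by auto
  then show ?thesis
    by simp
qed

lemma count_image_mset_lessThan:
  fixes n :: nat
  shows "count (image_mset c (mset_set {..<n})) j = card {i. i < n \<and> c i = j}"
  unfolding card_eq_sum_of_bool by (induction n) (simp_all add: lessThan_Suc del: sum_of_bool_eq)

text \<open>Every plane of index \<open>j\<close> contributes two positions, and the axis
  contributes one more to the index 0.\<close>

lemma card_div2_fibre: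
  fixes c :: "nat \<Rightarrow> nat"
  shows "card {i. i < 2 * n + 1 \<and> (if i < 2 * n then c (i div 2) else 0) = j}
    = 2 * card {i. i < n \<and> c i = j} + of_bool (j = 0)"
proof -
  define d where "d i = (if i < 2 * n then c (i div 2) else 0)" for i
  have d_last: "d (2 * n) = 0"
    by (simp add: d_def)
  have "(\<Sum>i<2 * p. of_bool (c (i div 2) = j)) = 2 * (\<Sum>i<p. of_bool (c i = j) :: nat)" for p
    by (induction p) (simp_all del: sum_of_bool_eq)
  moreover have "(\<Sum>i<2 * n. of_bool (d i = j)) = (\<Sum>i<2 * n. of_bool (c (i div 2) = j) :: nat)"
    by (rule sum.cong) (auto simp: d_def)
  ultimately have "(\<Sum>i<2 * n + 1. of_bool (d i = j) :: nat)
      = 2 * (\<Sum>i<n. of_bool (c i = j)) + of_bool (j = 0)"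
    by (simp add: d_last eq_commute[of 0 j] del: sum_of_bool_eq)
  then show ?thesis
    unfolding card_eq_sum_of_bool d_def .
qed

text \<open>The eigenspaces depend on \<open>f\<close> only, and their dimensions give the
  multiplicity of each index up to \<open>k\<close>; larger indices do not occur.\<close>

lemma rotation_basis_mset_unique:
  fixes f :: "'a::euclidean_space \<Rightarrow> 'a"
  assumes f: "orthogonal_transformation f" and dim: "DIM('a) = 2 * n + 1"
    and b: "rotation_basis (2 * k + 1) n f c b" "\<And>i. i < n \<Longrightarrow> c i \<le> k"
    and b': "rotation_basis (2 * k + 1) n f c' b'" "\<And>i. i < n \<Longrightarrow> c' i \<le> k"
  shows "image_mset c (mset_set {..<n}) = image_mset c' (mset_set {..<n})"
proof (rule multiset_eqI)
  fix j
  have "card {i. i < n \<and> c i = j} = card {i. i < n \<and> c' i = j}"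
  proof (cases "j \<le> k")
    case True
    then show ?thesis
      using rotation_basis_dim_eigenspace[OF f b(1) dim b(2), of j]
        rotation_basis_dim_eigenspace[OF f b'(1) dim b'(2), of j]
      unfolding card_div2_fibre by simp
  next
    case False
    then have "{i. i < n \<and> c i = j} = {}" "{i. i < n \<and> c' i = j} = {}"
      using b(2) b'(2) by auto
    then show ?thesis by (simp only:)
  qed
  then show "count (image_mset c (mset_set {..<n})) j = count (image_mset c' (mset_set {..<n})) j"
    by (simp add: count_image_mset_lessThan)
qed

section \<open>Maps with the same indices: intertwining, order and reordering of planes\<close>

text \<open>This is de Moivre's formula on one plane.\<close>

lemma rotates_funpow:
  assumes lin: "linear f" and r: "rotates f t v w"
  shows "rotates (f ^^ s) (real s * t) v w"
proof (induction s)
  case 0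
  then show ?case by (simp add: rotates_def)
next
  case (Suc s)
  have fv: "f v = cos t *\<^sub>R v + sin t *\<^sub>R w" and fw: "f w = cos t *\<^sub>R w - sin t *\<^sub>R v"
    using r by (simp_all add: rotates_def)
  have gv: "(f ^^ s) v = cos (real s * t) *\<^sub>R v + sin (real s * t) *\<^sub>R w"
    and gw: "(f ^^ s) w = cos (real s * t) *\<^sub>R w - sin (real s * t) *\<^sub>R v"
    using Suc by (simp_all add: rotates_def)
  have "real (Suc s) * t = t + real s * t"
    by (simp add: distrib_right)
  then show ?case
    unfolding rotates_def funpow.simps o_apply gv gw linear_add[OF lin] linear_diff[OF lin]
      linear_scale[OF lin] fv fw
    by (simp add: cos_add sin_add algebra_simps)
qed

lemma linear_eq_on_orthonormal:
  fixes f g :: "'a::euclidean_space \<Rightarrow> 'b::real_vector"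
  assumes "linear f" "linear g" "orthonormal_upto DIM('a) b"
    and eq: "\<And>i. i < DIM('a) \<Longrightarrow> f (b i) = g (b i)"
  shows "f = g"
proof
  fix x
  let ?s = "\<Sum>i<DIM('a). (b i \<bullet> x) *\<^sub>R b i"
  have "f ?s = g ?s"
    using eq by (simp add: linear_sum[OF assms(1)] linear_sum[OF assms(2)]
        linear_scale[OF assms(1)] linear_scale[OF assms(2)])
  then show "f x = g x"
    using orthonormal_upto_expansion[OF assms(3) refl] by simp
qed

text \<open>Both maps act by the same formulas on their bases, so a linear map matching the bases
  intertwines them. With \<open>h\<close> orthogonal this becomes conjugacy.\<close>

lemma rotation_basis_eqI:
  fixes f g h :: "'a::euclidean_space \<Rightarrow> 'a"
  assumes lin: "linear f" "linear g" "linear h" and dim: "DIM('a) = 2 * n + 1"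
    and f: "rotation_basis m n f c b" and g: "rotation_basis m n g c b'"
    and h: "\<And>i. i < 2 * n + 1 \<Longrightarrow> h (b i) = b' i"
  shows "h \<circ> f = g \<circ> h"
proof (rule linear_eq_on_orthonormal)
  show "linear (h \<circ> f)" "linear (g \<circ> h)"
    using lin by (simp_all add: linear_compose)
  show "orthonormal_upto DIM('a) b"
    using f dim by (simp add: rotation_basis_def)
  fix i assume "i < DIM('a)"
  then consider "i = 2 * n" | "i < 2 * n"
    using dim by linarith
  then show "(h \<circ> f) (b i) = (g \<circ> h) (b i)"
  proof cases
    case 1
    then show ?thesis
      using f g h by (simp add: rotation_basis_def)
  next
    case 2
    have "h (f (b (2 * q))) = g (h (b (2 * q)))" "h (f (b (2 * q + 1))) = g (h (b (2 * q + 1)))"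
      if "q < n" for q
      using f g h that
      by (auto simp: rotation_basis_def rotates_def linear_add[OF lin(3)] linear_diff[OF lin(3)]
          linear_scale[OF lin(3)])
    with 2 show ?thesis
      by (elim less_double_cases) auto
  qed
qed

lemma rotation_basis_funpow_eq_id:
  fixes f :: "'a::euclidean_space \<Rightarrow> 'a"
  assumes lin: "linear f" and dim: "DIM('a) = 2 * n + 1" and m: "m > 0"
    and b: "rotation_basis m n f c b"
  shows "f ^^ m = id"
proof (rule linear_eq_on_orthonormal)
  show "linear (f ^^ m)"
    using lin by (induction m) (simp_all add: linear_compose linear_id)
  show "linear (id :: 'a \<Rightarrow> 'a)"
    by (rule linear_id)
  show "orthonormal_upto DIM('a) b"
    using b dim by (simp add: rotation_basis_def)
  fix i assume "i < DIM('a)"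
  then consider "i = 2 * n" | "i < 2 * n"
    using dim by linarith
  then show "(f ^^ m) (b i) = id (b i)"
  proof cases
    case 1
    have "(f ^^ s) (b (2 * n)) = b (2 * n)" for s
      using b by (induction s) (simp_all add: rotation_basis_def)
    with 1 show ?thesis by simp
  next
    case 2
    have "(f ^^ m) (b (2 * q)) = b (2 * q)" "(f ^^ m) (b (2 * q + 1)) = b (2 * q + 1)"
      if "q < n" for q
      using rotates_funpow[OF lin, of "root_angle m (c q)" "b (2 * q)" "b (2 * q + 1)" m] b that
      by (simp_all add: rotation_basis_def rotates_def cos_mult_root_angle_period[OF m])
    with 2 show ?thesis
      by (elim less_double_cases) auto
  qed
qed

lemma orthonormal_upto_compose:
  assumes "orthonormal_upto N b" "inj_on s {..<N}" "s ` {..<N} \<subseteq> {..<N}"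
  shows "orthonormal_upto N (b \<circ> s)"
  using assms by (auto simp: orthonormal_upto_def inj_on_eq_iff image_subset_iff)

lemma rotation_basis_permute:
  assumes b: "rotation_basis m n f c b" and p: "p permutes {..<n}"
    and c': "\<And>i. i < n \<Longrightarrow> c' i = c (p i)"
  shows "\<exists>b'. rotation_basis m n f c' b'"
proof -
  \<comment> \<open>\<open>s\<close> lifts \<open>p\<close> from planes to positions: pairs move as
    blocks, keeping their inner order, and the axis stays in place.\<close>
  define s where "s i = (if i < 2 * n then 2 * p (i div 2) + i mod 2 else i)" for i
  have p_less: "p i < n" if "i < n" for i
    using permutes_in_image[OF p, of i] that by simp
  have s_even: "s (2 * i) = 2 * p i" and s_odd: "s (2 * i + 1) = 2 * p i + 1" if "i < n" for i
    using that by (auto simp: s_def)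
  have s_less: "s i < 2 * n" if "i < 2 * n" for i
    using that by (elim less_double_cases) (use p_less s_even s_odd in force)+
  have "inj_on s {..<2 * n + 1}"
  proof (rule inj_onI)
    fix i j assume ij: "i \<in> {..<2 * n + 1}" "j \<in> {..<2 * n + 1}" and eq: "s i = s j"
    have "i < 2 * n \<longleftrightarrow> j < 2 * n"
      using s_less[of i] s_less[of j] eq ij by (metis s_def)
    then show "i = j"
    proof (cases "i < 2 * n")
      case True
      with \<open>i < 2 * n \<longleftrightarrow> j < 2 * n\<close> eq
      have e: "2 * p (i div 2) + i mod 2 = 2 * p (j div 2) + j mod 2"
        by (simp add: s_def)
      then have "p (i div 2) = p (j div 2)" "i mod 2 = j mod 2"
        by presburger+
      then show ?thesis
        using permutes_inj[OF p] by (metis injD div_mod_decomp)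
    qed (use ij in auto)
  qed
  moreover have "s ` {..<2 * n + 1} \<subseteq> {..<2 * n + 1}"
    using s_less by (force simp: s_def)
  ultimately have "orthonormal_upto (2 * n + 1) (b \<circ> s)"
    using b by (intro orthonormal_upto_compose) (simp_all add: rotation_basis_def)
  moreover have "rotates f (root_angle m (c' i)) ((b \<circ> s) (2 * i)) ((b \<circ> s) (2 * i + 1))"
    if "i < n" for i
    using b p_less[OF that] s_even[OF that] s_odd[OF that] c'[OF that]
    by (simp add: rotation_basis_def)
  moreover have "f ((b \<circ> s) (2 * n)) = (b \<circ> s) (2 * n)"
    using b by (simp add: rotation_basis_def s_def)
  ultimately have "rotation_basis m n f c' (b \<circ> s)"
    by (simp add: rotation_basis_def)
  then show ?thesis by blast
qed

lemma rotation_basis_same_mset: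
  assumes b: "rotation_basis m n f c b"
    and eq: "image_mset c' (mset_set {..<n}) = image_mset c (mset_set {..<n})"
  shows "\<exists>b'. rotation_basis m n f c' b'"
proof -
  obtain p where "p permutes {..<n}" "\<forall>i\<in>{..<n}. c' i = c (p i)"
    using image_mset_eq_implies_permutes[OF _ eq] by auto
  then show ?thesis
    using rotation_basis_permute[OF b] by auto
qed

section \<open>Orthogonal matrices with prescribed action on a basis\<close>

text \<open>The index type \<open>'d\<close> carries no numbering of its own, so \<open>e\<close>
  supplies one; the columns of the matrix are the given vectors.\<close>

lemma orthogonal_matrix_of_basis:
  fixes b :: "nat \<Rightarrow> real ^ 'd"
  assumes b: "orthonormal_upto CARD('d) b" and e: "bij_betw e (UNIV :: 'd set) {..<CARD('d)}"
  obtains B where "orthogonal_matrix B" "\<And>s. B *v axis s 1 = b (e s)"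
proof -
  define B :: "real ^ 'd ^ 'd" where "B = (\<chi> r s. b (e s) $ r)"
  have column: "column s B = b (e s)" for s
    by (simp add: B_def column_def vec_eq_iff)
  have less: "e s < CARD('d)" for s
    using bij_betwE[OF e] by blast
  have "b (e s) \<bullet> b (e s') = of_bool (s = s')" for s s'
    using orthonormal_uptoD[OF b less less, of s s'] bij_betw_imp_inj_on[OF e]
    by (simp add: inj_eq)
  then have "orthogonal_matrix B"
    by (simp add: orthogonal_matrix_orthonormal_columns column orthogonal_def norm_eq_1)
  moreover have "B *v axis s 1 = b (e s)" for s
    by (simp add: matrix_vector_mult_basis column)
  ultimately show thesis
    by (rule that)
qed

text \<open>The change of basis passes through the standard basis: \<open>transpose B\<close> takes
  \<open>b i\<close> back to an axis vector and \<open>W\<close> sends that one to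
  \<open>w i\<close>.\<close>

lemma orthonormal_upto_transfer:
  fixes b w :: "nat \<Rightarrow> real ^ 'd"
  assumes b: "orthonormal_upto CARD('d) b" and w: "orthonormal_upto CARD('d) w"
  obtains Q where "orthogonal_matrix Q" "\<And>i. i < CARD('d) \<Longrightarrow> Q *v b i = w i"
proof -
  obtain e where e: "bij_betw e (UNIV :: 'd set) {..<CARD('d)}"
    using finite_same_card_bij[of "UNIV :: 'd set" "{..<CARD('d)}"] by auto
  obtain B where B: "orthogonal_matrix B" "\<And>s. B *v axis s 1 = b (e s)"
    using orthogonal_matrix_of_basis[OF b e] by blast
  obtain W where W: "orthogonal_matrix W" "\<And>s. W *v axis s 1 = w (e s)"
    using orthogonal_matrix_of_basis[OF w e] by blast
  have "(W ** transpose B) *v b i = w i" if i: "i < CARD('d)" for i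
  proof -
    obtain s where s: "i = e s"
      using e i unfolding bij_betw_def by blast
    have "transpose B *v b i = (transpose B ** B) *v axis s 1"
      by (simp add: s B(2) flip: matrix_vector_mul_assoc)
    also have "\<dots> = axis s 1"
      using B(1) by (simp add: orthogonal_matrix_def)
    finally show ?thesis
      by (simp add: s W(2) flip: matrix_vector_mul_assoc)
  qed
  moreover have "orthogonal_matrix (W ** transpose B)"
    using B(1) W(1) by (simp add: orthogonal_matrix_mul)
  ultimately show thesis
    using that by blast
qed

lemma orthonormal_upto_CARD_exists: "\<exists>b :: nat \<Rightarrow> real ^ 'd. orthonormal_upto CARD('d) b"
proof -
  obtain e where e: "bij_betw e {..<CARD('d)} (UNIV :: 'd set)"
    using finite_same_card_bij[of "{..<CARD('d)}" "UNIV :: 'd set"] by auto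
  have "orthonormal_upto CARD('d) (\<lambda>i. axis (e i) 1 :: real ^ 'd)"
    using bij_betw_imp_inj_on[OF e]
    by (auto simp: orthonormal_upto_def inner_axis_axis inj_on_eq_iff)
  then show ?thesis by blast
qed

lemma orthogonal_transformation_matrix_vector:
  fixes A :: "real ^ 'd ^ 'd"
  shows "orthogonal_transformation ((*v) A) \<longleftrightarrow> orthogonal_matrix A"
  by (simp add: orthogonal_transformation_matrix)

lemma rotation_basis_conj:
  fixes A Q :: "real ^ 'd ^ 'd"
  assumes Q: "orthogonal_matrix Q" and b: "rotation_basis m n ((*v) A) c b"
  shows "rotation_basis m n ((*v) (Q ** A ** transpose Q)) c (\<lambda>i. Q *v b i)"
proof -
  have "(Q ** A ** transpose Q) *v (Q *v x) = (Q ** A ** (transpose Q ** Q)) *v x" for x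
    by (simp add: matrix_vector_mul_assoc matrix_mul_assoc)
  then have conj: "(Q ** A ** transpose Q) *v (Q *v x) = Q *v (A *v x)" for x
    using Q by (simp add: orthogonal_matrix_def matrix_vector_mul_assoc)
  have "(Q *v x) \<bullet> (Q *v y) = x \<bullet> y" for x y
    using Q orthogonal_transformation_matrix_vector[of Q]
    by (simp add: orthogonal_transformation_def)
  then show ?thesis
    using b by (simp add: rotation_basis_def orthonormal_upto_def rotates_def conj
        matrix_vector_right_distrib matrix_vector_mult_diff_distrib matrix_vector_mult_scaleR)
qed

lemma rotation_basis_conjugate:
  fixes A B :: "real ^ 'd ^ 'd"
  assumes dim: "CARD('d) = 2 * n + 1"
    and A: "rotation_basis m n ((*v) A) c b" and B: "rotation_basis m n ((*v) B) c b'"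
  obtains Q where "orthogonal_matrix Q" "B = Q ** A ** transpose Q"
proof -
  obtain Q where Q: "orthogonal_matrix Q" "\<And>i. i < CARD('d) \<Longrightarrow> Q *v b i = b' i"
    using orthonormal_upto_transfer[of b b'] A B dim by (auto simp: rotation_basis_def)
  have "(*v) Q \<circ> (*v) A = (*v) B \<circ> (*v) Q"
    using Q(2) dim by (intro rotation_basis_eqI[OF _ _ _ _ A B]) simp_all
  then have "Q ** A = B ** Q"
    by (simp add: matrix_eq fun_eq_iff flip: matrix_vector_mul_assoc)
  then have "Q ** A ** transpose Q = B ** (Q ** transpose Q)"
    by (simp add: matrix_mul_assoc)
  then show thesis
    using that Q(1) by (simp add: orthogonal_matrix_def)
qed

lemma rotation_basis_matrix_exists:
  assumes dim: "CARD('d::finite) = 2 * n + 1"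
  obtains A :: "real ^ 'd ^ 'd" and b where "orthogonal_matrix A" "rotation_basis m n ((*v) A) c b"
proof -
  obtain b :: "nat \<Rightarrow> real ^ 'd" where b: "orthonormal_upto CARD('d) b"
    using orthonormal_upto_CARD_exists by blast
  define t where "t i = root_angle m (c i)" for i
  \<comment> \<open>These are the intended images of the \<open>b i\<close> under the block
    rotation. Once they are known to be orthonormal, the transfer lemma yields the matrix.\<close>
  define w where "w i = (if i = 2 * n then b i
    else if even i then cos (t (i div 2)) *\<^sub>R b i + sin (t (i div 2)) *\<^sub>R b (i + 1)
    else cos (t (i div 2)) *\<^sub>R b i - sin (t (i div 2)) *\<^sub>R b (i - 1))" for i
  have ip: "b i \<bullet> b j = of_bool (i = j)" if "i < 2 * n + 1" "j < 2 * n + 1" for i j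
    using orthonormal_uptoD[OF b, of i j] that dim by simp
  have w_last: "w (2 * n) = b (2 * n)"
    by (simp add: w_def)
  have w_even: "w (2 * q) = cos (t q) *\<^sub>R b (2 * q) + sin (t q) *\<^sub>R b (2 * q + 1)"
    and w_odd: "w (2 * q + 1) = cos (t q) *\<^sub>R b (2 * q + 1) - sin (t q) *\<^sub>R b (2 * q)" if "q < n" for q
  proof -
    have "2 * q + 1 \<noteq> 2 * n"
      by presburger
    then show "w (2 * q) = cos (t q) *\<^sub>R b (2 * q) + sin (t q) *\<^sub>R b (2 * q + 1)"
      "w (2 * q + 1) = cos (t q) *\<^sub>R b (2 * q + 1) - sin (t q) *\<^sub>R b (2 * q)"
      using that by (simp_all add: w_def)
  qed
  have parity: "2 * q \<noteq> 2 * r + 1" "2 * q + 1 \<noteq> 2 * r" for q r :: nat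
    by presburger+
  have ww: "w (2 * q) \<bullet> w (2 * r) = of_bool (q = r)"
    "w (2 * q + 1) \<bullet> w (2 * r + 1) = of_bool (q = r)"
    "w (2 * q) \<bullet> w (2 * r + 1) = 0"
    if "q < n" "r < n" for q r
    using that
    by (cases "q = r"; simp add: w_even w_odd ip parity inner_add_left inner_add_right
        inner_diff_left inner_diff_right del: One_nat_def add_Suc_right)+
  have wl: "w (2 * q) \<bullet> b (2 * n) = 0" "w (2 * q + 1) \<bullet> b (2 * n) = 0" if "q < n" for q
    using that
    by (simp_all add: w_even w_odd ip parity inner_add_left inner_diff_left
        del: One_nat_def add_Suc_right)
  have "w i \<bullet> w j = of_bool (i = j)" if "i < 2 * n + 1" "j < 2 * n + 1" for i j
  proof -
    have "i = 2 * n \<or> (\<exists>q<n. i = 2 * q) \<or> (\<exists>q<n. i = 2 * q + 1)"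
      "j = 2 * n \<or> (\<exists>q<n. j = 2 * q) \<or> (\<exists>q<n. j = 2 * q + 1)"
      using that by presburger+
    then show ?thesis
      using ww wl ip[of "2 * n" "2 * n"] parity
      by (elim disjE exE conjE) (simp_all add: w_last inner_commute)
  qed
  then have w: "orthonormal_upto CARD('d) w"
    by (simp add: orthonormal_upto_def dim)
  obtain A where A: "orthogonal_matrix A" "\<And>i. i < CARD('d) \<Longrightarrow> A *v b i = w i"
    using orthonormal_upto_transfer[OF b w] by blast
  have "rotation_basis m n ((*v) A) c b"
    using b w_even w_odd w_last
    by (simp add: rotation_basis_def rotates_def A(2) dim t_def)
  with A(1) show thesis
    by (rule that)
qed

section \<open>Classification and count of the conjugacy classes\<close>

lemma nat_pow_orthogonal_group:
  fixes A :: "real ^ 'd ^ 'd"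
  shows "(*v) (A [^]\<^bsub>orthogonal_group\<^esub> t) = ((*v) A) ^^ t"
proof (induction t)
  case 0
  then show ?case by (simp add: fun_eq_iff)
next
  case (Suc t)
  then show ?case
    by (simp add: fun_eq_iff funpow_swap1 flip: matrix_vector_mul_assoc)
qed

lemma orthogonal_group_pow_eq_one_iff:
  fixes A :: "real ^ 'd ^ 'd"
  shows "A [^]\<^bsub>orthogonal_group\<^esub> t = \<one>\<^bsub>orthogonal_group\<^esub> \<longleftrightarrow> ((*v) A) ^^ t = id"
  by (simp add: matrix_eq fun_eq_iff flip: nat_pow_orthogonal_group)

text \<open>Passing to the multiset forgets the order of the planes. In dimension
  \<open>2 * n + 1\<close>, each such nonempty set turns out to be one conjugacy class.\<close>

definition rotation_class :: "nat \<Rightarrow> nat \<Rightarrow> nat multiset \<Rightarrow> (real ^ 'd ^ 'd) set" where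
  "rotation_class m n M = {A. orthogonal_matrix A \<and>
     (\<exists>c b. rotation_basis m n ((*v) A) c b \<and> image_mset c (mset_set {..<n}) = M)}"

lemma image_mset_nat_exists:
  fixes M :: "'a multiset"
  shows "\<exists>c :: nat \<Rightarrow> 'a. image_mset c (mset_set {..<size M}) = M"
proof -
  obtain xs where xs: "mset xs = M"
    using ex_mset by blast
  have "image_mset (nth xs) (mset [0..<length xs]) = mset xs"
    by (metis map_nth mset_map)
  then show ?thesis
    using xs by (auto simp: mset_set_upto_eq_mset_upto)
qed

lemma rotation_class_nonempty:
  assumes "CARD('d::finite) = 2 * n + 1" "size M = n"
  shows "(rotation_class m n M :: (real ^ 'd ^ 'd) set) \<noteq> {}"
proof -
  obtain c where "image_mset c (mset_set {..<n}) = M"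
    using image_mset_nat_exists[of M] assms(2) by auto
  moreover obtain A :: "real ^ 'd ^ 'd" and b where
    "orthogonal_matrix A" "rotation_basis m n ((*v) A) c b"
    using rotation_basis_matrix_exists[OF assms(1)] by blast
  ultimately show ?thesis
    by (auto simp: rotation_class_def)
qed

text \<open>Conjugation by \<open>Q\<close> moves a rotation basis by \<open>Q\<close> and keeps the
  indices. Conversely, equal multisets allow the planes of \<open>B\<close> to be reordered to match
  those of \<open>A\<close>, and an orthogonal matrix then carries one basis to the other.\<close>

lemma conj_class_eq_rotation_class:
  fixes A :: "real ^ 'd ^ 'd"
  assumes dim: "CARD('d) = 2 * n + 1" and A: "A \<in> rotation_class m n M"
  shows "conj_class orthogonal_group A = rotation_class m n M"
proof -
  obtain c b where cb: "rotation_basis m n ((*v) A) c b" "image_mset c (mset_set {..<n}) = M"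
    and orth: "orthogonal_matrix A"
    using A by (auto simp: rotation_class_def)
  have conj: "conj_class orthogonal_group A = {Q ** A ** transpose Q | Q. orthogonal_matrix Q}"
    by (auto simp: conj_class_def) (metis inv_orthogonal_group)+
  show ?thesis
  proof (intro equalityI subsetI)
    fix B assume "B \<in> conj_class orthogonal_group A"
    then obtain Q where Q: "orthogonal_matrix Q" "B = Q ** A ** transpose Q"
      by (auto simp: conj)
    have "orthogonal_matrix B"
      using Q orth by (simp add: orthogonal_matrix_mul)
    then show "B \<in> rotation_class m n M"
      using rotation_basis_conj[OF Q(1) cb(1)] cb(2) Q(2) by (auto simp: rotation_class_def)
  next
    fix B :: "real ^ 'd ^ 'd" assume "B \<in> rotation_class m n M"
    then obtain c' b' where "rotation_basis m n ((*v) B) c' b'"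
      "image_mset c' (mset_set {..<n}) = M"
      by (auto simp: rotation_class_def)
    then obtain b'' where "rotation_basis m n ((*v) B) c b''"
      using rotation_basis_same_mset[of m n _ c' b' c] cb(2) by blast
    then obtain Q where "orthogonal_matrix Q" "B = Q ** A ** transpose Q"
      using rotation_basis_conjugate[OF dim cb(1)] by blast
    then show "B \<in> conj_class orthogonal_group A"
      unfolding conj by blast
  qed
qed

lemma rotation_class_subset:
  assumes dim: "CARD('d::finite) = 2 * n + 1" and m: "m > 0"
  shows "(rotation_class m n M :: (real ^ 'd ^ 'd) set)
    \<subseteq> {A \<in> carrier orthogonal_group. A [^]\<^bsub>orthogonal_group\<^esub> m = \<one>\<^bsub>orthogonal_group\<^esub>}"
proof
  fix A :: "real ^ 'd ^ 'd" assume "A \<in> rotation_class m n M"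
  then obtain c b where orth: "orthogonal_matrix A" and b: "rotation_basis m n ((*v) A) c b"
    by (auto simp: rotation_class_def)
  have "((*v) A) ^^ m = id"
    by (rule rotation_basis_funpow_eq_id[OF _ _ m b]) (simp_all add: dim)
  then show "A \<in> {A \<in> carrier orthogonal_group.
      A [^]\<^bsub>orthogonal_group\<^esub> m = \<one>\<^bsub>orthogonal_group\<^esub>}"
    unfolding mem_Collect_eq orthogonal_group_pow_eq_one_iff using orth by simp
qed

lemma rotation_class_exists:
  fixes A :: "real ^ 'd ^ 'd"
  assumes dim: "CARD('d) = 2 * n + 1" and orth: "orthogonal_matrix A"
    and pow: "A [^]\<^bsub>orthogonal_group\<^esub> (2 * k + 1) = \<one>\<^bsub>orthogonal_group\<^esub>"
  shows "\<exists>M\<in>multisets_of_size {..k} n. A \<in> rotation_class (2 * k + 1) n M"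
proof -
  have period: "((*v) A) ^^ (2 * k + 1) = id"
    using pow unfolding orthogonal_group_pow_eq_one_iff .
  have f: "orthogonal_transformation ((*v) A)"
    using orth by (simp add: orthogonal_transformation_matrix_vector)
  have "DIM(real ^ 'd) = 2 * n + 1"
    by (simp add: dim)
  then obtain c b where c: "\<And>i. i < n \<Longrightarrow> c i \<le> k" and b: "rotation_basis (2 * k + 1) n ((*v) A) c b"
    using rotation_basis_exists[OF f period, of n] by blast
  have "image_mset c (mset_set {..<n}) \<in> multisets_of_size {..k} n"
    using c by (auto simp: multisets_of_size_def)
  then show ?thesis
    using orth b by (auto simp: rotation_class_def)
qed

text \<open>The bound by \<open>k\<close> is essential: the indices \<open>j\<close> and
  \<open>2 * k + 1 - j\<close> describe the same rotation with the two vectors of the plane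
  exchanged.\<close>

lemma rotation_class_inj:
  fixes A :: "real ^ 'd ^ 'd"
  assumes dim: "CARD('d) = 2 * n + 1"
    and M: "M \<in> multisets_of_size {..k} n" "A \<in> rotation_class (2 * k + 1) n M"
    and M': "M' \<in> multisets_of_size {..k} n" "A \<in> rotation_class (2 * k + 1) n M'"
  shows "M = M'"
proof -
  obtain c b where cb: "rotation_basis (2 * k + 1) n ((*v) A) c b"
    "image_mset c (mset_set {..<n}) = M"
    using M(2) by (auto simp: rotation_class_def)
  obtain c' b' where cb': "rotation_basis (2 * k + 1) n ((*v) A) c' b'"
    "image_mset c' (mset_set {..<n}) = M'"
    using M'(2) by (auto simp: rotation_class_def)
  have f: "orthogonal_transformation ((*v) A)"
    using M(2) by (simp add: orthogonal_transformation_matrix_vector rotation_class_def)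
  have "DIM(real ^ 'd) = 2 * n + 1"
    by (simp add: dim)
  moreover have "c i \<le> k" "c' i \<le> k" if "i < n" for i
    using M(1) M'(1) that by (auto simp: multisets_of_size_def simp flip: cb(2) cb'(2))
  ultimately show ?thesis
    using rotation_basis_mset_unique[OF f _ cb(1) _ cb'(1)] cb(2) cb'(2) by blast
qed

theorem theorem10:
  fixes n k m :: nat
  assumes "n \<ge> 1"
    and "m = 2 * k + 1"
    and "CARD('d::finite) = 2 * n + 1"
  shows "num_conj_classes_exponent (orthogonal_group :: (real ^ 'd ^ 'd) monoid) m
           = (n + m div 2) choose (m div 2)"
proof -
  let ?G = "orthogonal_group :: (real ^ 'd ^ 'd) monoid"
  let ?T = "{A \<in> carrier ?G. A [^]\<^bsub>?G\<^esub> m = \<one>\<^bsub>?G\<^esub>}"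
  let ?S = "multisets_of_size {..k} n"
  let ?R = "rotation_class m n :: nat multiset \<Rightarrow> (real ^ 'd ^ 'd) set"
  note dim = assms(3)
  have m: "m > 0"
    using assms(2) by simp
  have nonempty: "?R M \<noteq> {}" if "M \<in> ?S" for M
    using rotation_class_nonempty[OF dim] that by (auto simp: multisets_of_size_def)
  have "{C \<in> conj_classes ?G. C \<subseteq> ?T} = ?R ` ?S"
  proof (intro equalityI subsetI)
    fix C assume C: "C \<in> {C \<in> conj_classes ?G. C \<subseteq> ?T}"
    then obtain A where A: "orthogonal_matrix A" "C = conj_class ?G A"
      by (auto simp: conj_classes_def)
    \<comment> \<open>Conjugating by the identity puts \<open>A\<close> in its own class, so
      \<open>A\<close> inherits the exponent \<open>m\<close> from the inclusion of the class in
      \<open>?T\<close>.\<close>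
    have "A = mat 1 ** A ** transpose (mat 1)"
      by simp
    then have "A \<in> C"
      unfolding A(2) conj_class_def
      by (auto simp: inv_orthogonal_group orthogonal_matrix_id intro!: exI[of _ "mat 1"])
    then have "A [^]\<^bsub>?G\<^esub> m = \<one>\<^bsub>?G\<^esub>"
      using C by blast
    then obtain M where "M \<in> ?S" "A \<in> ?R M"
      using rotation_class_exists[OF dim A(1)] unfolding assms(2) by blast
    then show "C \<in> ?R ` ?S"
      using conj_class_eq_rotation_class[OF dim] A(2) by blast
  next
    fix C assume "C \<in> ?R ` ?S"
    then obtain M where M: "M \<in> ?S" "C = ?R M"
      by blast
    obtain A where A: "A \<in> ?R M"
      using nonempty[OF M(1)] by blast
    then have "A \<in> carrier ?G"
      by (simp add: rotation_class_def)
    then have "C \<in> conj_classes ?G"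
      using conj_class_eq_rotation_class[OF dim A] M(2) by (auto simp: conj_classes_def)
    moreover have "C \<subseteq> ?T"
      unfolding M(2) by (rule rotation_class_subset[OF dim m])
    ultimately show "C \<in> {C \<in> conj_classes ?G. C \<subseteq> ?T}"
      by blast
  qed
  \<comment> \<open>The classes are nonempty, and a common member determines the multiset.\<close>
  moreover have "inj_on ?R ?S"
  proof (rule inj_onI)
    fix M M' assume M: "M \<in> ?S" "M' \<in> ?S" "?R M = ?R M'"
    obtain A where "A \<in> ?R M"
      using nonempty[OF M(1)] by blast
    then show "M = M'"
      using rotation_class_inj[OF dim M(1) _ M(2)] M(3) unfolding assms(2) by blast
  qed
  ultimately have "num_conj_classes_exponent ?G m = card ?S"
    by (simp add: num_conj_classes_exponent_def card_image)
  \<comment> \<open>Stars and bars: multisets of size \<open>n\<close> over the \<open>k + 1\<close>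
    indices \<open>0, ..., k\<close>, where \<open>k = m div 2\<close>.\<close>
  also have "\<dots> = (n + k) choose n"
    by (simp add: card_multisets_of_size add.commute)
  also have "\<dots> = (n + k) choose k"
    using binomial_symmetric[of n "n + k"] by simp
  finally show ?thesis
    by (simp add: assms(2))
qed

end
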